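(* Every simple FG-quasigroup is medial or is a group.
   Context: A quasigroup is a non-empty set $Q$ with a binary operation (written multiplicatively) such that all left translations $L_a:x\mapsto ax$ and all right translations $R_a:x\mapsto xa$ are permutations of $Q$. Juxtaposition binds more tightly than $\cdot$, so $xy\cdot zw$ means $(xy)(zw)$. In a quasigroup the maps $\alpha,\beta:Q\to Q$ are defined by $x\,\alpha(x)=x=\beta(x)\,x$. $Q$ is a left F-quasigroup if $x\cdot yz = xy\cdot\alpha(x)z$ for all $x,y,z\in Q$; a right F-quasigroup if $zy\cdot x = z\beta(x)\cdot yx$ for all $x,y,z\in Q$; an F-quasigroup if it is both. A quasigroup $(Q,\cdot)$ is isotopic to a group $(G,+)$ if there are bijections $a,b,c:Q\to G$ with $c(xy)=a(x)+b(y)$ for all $x,y\in Q$. An FG-quasigroup is an F-quasigroup isotopic to a (possibly noncommutative) group. A quasigroup is medial if $xa\cdot by=xb\cdot ay$ for all its elements $x,y,a,b$. A normal congruence of a quasigroup $Q$ is an equivalence relation on $Q$ compatible with multiplication and with left and right division, so that the quotient is again a quasigroup. A quasigroup is simple if its only normal congruences are the equality relation and the all relation $Q\times Q$. *)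

theory Defs
  imports "HOL-Algebra.Group"
begin

locale quasigroup =
  fixes Q :: "'a set" and mul :: "'a \<Rightarrow> 'a \<Rightarrow> 'a" (infixl "\<cdot>" 70)
  assumes nonempty: "Q \<noteq> {}"
    and bij_left: "a \<in> Q \<Longrightarrow> bij_betw (\<lambda>x. a \<cdot> x) Q Q"
    and bij_right: "a \<in> Q \<Longrightarrow> bij_betw (\<lambda>x. x \<cdot> a) Q Q"
begin

(* ldiv a b is the solution x of a x = b, and rdiv b a is the solution x of x a = b. *)

definition ldiv :: "'a \<Rightarrow> 'a \<Rightarrow> 'a" where
  "ldiv a b = the_inv_into Q (\<lambda>x. a \<cdot> x) b"

definition rdiv :: "'a \<Rightarrow> 'a \<Rightarrow> 'a" where
  "rdiv b a = the_inv_into Q (\<lambda>x. x \<cdot> a) b"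

definition \<alpha> :: "'a \<Rightarrow> 'a" where
  "\<alpha> x = (THE y. y \<in> Q \<and> x \<cdot> y = x)"

definition \<beta> :: "'a \<Rightarrow> 'a" where
  "\<beta> x = (THE y. y \<in> Q \<and> y \<cdot> x = x)"

definition normal_congruence :: "('a \<times> 'a) set \<Rightarrow> bool" where
  "normal_congruence \<theta> \<longleftrightarrow> equiv Q \<theta> \<and>
     (\<forall>x x' y y'. (x, x') \<in> \<theta> \<longrightarrow> (y, y') \<in> \<theta> \<longrightarrow>
        (x \<cdot> y, x' \<cdot> y') \<in> \<theta> \<and>
        (ldiv x y, ldiv x' y') \<in> \<theta> \<and>
        (rdiv x y, rdiv x' y') \<in> \<theta>)"

lemma mul_closed: "a \<in> Q \<Longrightarrow> b \<in> Q \<Longrightarrow> a \<cdot> b \<in> Q"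
  using bij_left by (blast dest: bij_betwE)

lemma ldiv: assumes "a \<in> Q" "b \<in> Q" shows "ldiv a b \<in> Q" "a \<cdot> ldiv a b = b"
  using assms bij_left[of a] the_inv_into_into[of "\<lambda>x. a \<cdot> x" Q b Q]
    f_the_inv_into_f[of "\<lambda>x. a \<cdot> x" Q b]
  by (auto simp: bij_betw_def ldiv_def)

lemma rdiv: assumes "a \<in> Q" "b \<in> Q" shows "rdiv b a \<in> Q" "rdiv b a \<cdot> a = b"
  using assms bij_right[of a] the_inv_into_into[of "\<lambda>x. x \<cdot> a" Q b Q]
    f_the_inv_into_f[of "\<lambda>x. x \<cdot> a" Q b]
  by (auto simp: bij_betw_def rdiv_def)

lemma \<alpha>_eq_ldiv: "\<alpha> x = ldiv x x"
  by (simp add: \<alpha>_def ldiv_def the_inv_into_def)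

lemma \<beta>_eq_rdiv: "\<beta> x = rdiv x x"
  by (simp add: \<beta>_def rdiv_def the_inv_into_def)

lemma \<alpha>: "x \<in> Q \<Longrightarrow> \<alpha> x \<in> Q" "x \<in> Q \<Longrightarrow> x \<cdot> \<alpha> x = x"
  by (simp_all add: \<alpha>_eq_ldiv ldiv)

lemma \<beta>: "x \<in> Q \<Longrightarrow> \<beta> x \<in> Q" "x \<in> Q \<Longrightarrow> \<beta> x \<cdot> x = x"
  by (simp_all add: \<beta>_eq_rdiv rdiv)

end

locale left_F_quasigroup = quasigroup +
  assumes left_F: "\<lbrakk>x \<in> Q; y \<in> Q; z \<in> Q\<rbrakk> \<Longrightarrow> x \<cdot> (y \<cdot> z) = (x \<cdot> y) \<cdot> (\<alpha> x \<cdot> z)"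

locale right_F_quasigroup = quasigroup +
  assumes right_F: "\<lbrakk>x \<in> Q; y \<in> Q; z \<in> Q\<rbrakk> \<Longrightarrow> (z \<cdot> y) \<cdot> x = (z \<cdot> \<beta> x) \<cdot> (y \<cdot> x)"

locale F_quasigroup = left_F_quasigroup + right_F_quasigroup

locale medial_quasigroup = quasigroup +
  assumes medial: "\<lbrakk>x \<in> Q; a \<in> Q; b \<in> Q; y \<in> Q\<rbrakk> \<Longrightarrow> (x \<cdot> a) \<cdot> (b \<cdot> y) = (x \<cdot> b) \<cdot> (a \<cdot> y)"

locale simple_quasigroup = quasigroup +
  assumes simple: "normal_congruence \<theta> \<Longrightarrow> \<theta> = Id_on Q \<or> \<theta> = Q \<times> Q"

definition isotopic_to :: "'a set \<Rightarrow> ('a \<Rightarrow> 'a \<Rightarrow> 'a) \<Rightarrow> ('b, 'm) monoid_scheme \<Rightarrow> bool" where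
  "isotopic_to Q mul G \<longleftrightarrow>
     (\<exists>a b c. bij_betw a Q (carrier G) \<and> bij_betw b Q (carrier G) \<and> bij_betw c Q (carrier G) \<and>
        (\<forall>x\<in>Q. \<forall>y\<in>Q. c (mul x y) = a x \<otimes>\<^bsub>G\<^esub> b y))"

(* HOL cannot quantify over types inside a formula, so the group is taken over the type of
   the elements of Q; by isotopic_to_group_transfer below this is no restriction. *)

locale FG_quasigroup = F_quasigroup Q mul
  for Q :: "'a set" and mul :: "'a \<Rightarrow> 'a \<Rightarrow> 'a" (infixl "\<cdot>" 70) +
  assumes isotopic_group: "\<exists>G :: 'a monoid. group G \<and> isotopic_to Q mul G"

definition is_group :: "'a set \<Rightarrow> ('a \<Rightarrow> 'a \<Rightarrow> 'a) \<Rightarrow> bool" where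
  "is_group Q mul \<longleftrightarrow> (\<exists>e. group \<lparr>carrier = Q, monoid.mult = mul, one = e\<rparr>)"

lemma isotopic_to_group_transfer:
  fixes Q :: "'a set" and G :: "('b, 'm) monoid_scheme"
  assumes G: "group G" and iso: "isotopic_to Q mul G"
  shows "\<exists>H :: 'a monoid. group H \<and> isotopic_to Q mul H"
proof -
  interpret group G by (rule G)
  obtain a b c where a: "bij_betw a Q (carrier G)" and b: "bij_betw b Q (carrier G)"
    and c: "bij_betw c Q (carrier G)"
    and eq: "\<And>x y. x \<in> Q \<Longrightarrow> y \<in> Q \<Longrightarrow> c (mul x y) = a x \<otimes>\<^bsub>G\<^esub> b y"
    using iso unfolding isotopic_to_def by blast
  define d where "d = the_inv_into Q c"
  have d: "bij_betw d (carrier G) Q"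
    unfolding d_def by (rule bij_betw_the_inv_into[OF c])
  have dQ: "d g \<in> Q" if "g \<in> carrier G" for g using d that by (blast dest: bij_betwE)
  have cG: "c x \<in> carrier G" if "x \<in> Q" for x using c that by (blast dest: bij_betwE)
  have cd: "c (d g) = g" if "g \<in> carrier G" for g
    unfolding d_def using c that by (simp add: f_the_inv_into_f_bij_betw)
  have dc: "d (c x) = x" if "x \<in> Q" for x
    unfolding d_def using c that by (simp add: bij_betw_def the_inv_into_f_f)
  define H where "H = \<lparr>carrier = Q, monoid.mult = (\<lambda>x y. d (c x \<otimes>\<^bsub>G\<^esub> c y)), one = d \<one>\<^bsub>G\<^esub>\<rparr>"
  have "group H"
  proof (rule groupI)
    fix x assume "x \<in> carrier H"
    then have x: "x \<in> Q" by (simp add: H_def)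
    show "\<exists>y\<in>carrier H. y \<otimes>\<^bsub>H\<^esub> x = \<one>\<^bsub>H\<^esub>"
      by (rule bexI[of _ "d (inv\<^bsub>G\<^esub> c x)"]) (use x in \<open>simp_all add: H_def dQ cG cd\<close>)
  qed (simp_all add: H_def dQ cG cd dc m_assoc)
  moreover have "isotopic_to Q mul H"
    unfolding isotopic_to_def
  proof (intro exI conjI ballI)
    show "bij_betw (d \<circ> a) Q (carrier H)" "bij_betw (d \<circ> b) Q (carrier H)"
      "bij_betw (d \<circ> c) Q (carrier H)"
      using bij_betw_trans[OF a d] bij_betw_trans[OF b d] bij_betw_trans[OF c d]
      by (simp_all add: H_def)
    fix x y assume "x \<in> Q" "y \<in> Q"
    then show "(d \<circ> c) (mul x y) = (d \<circ> a) x \<otimes>\<^bsub>H\<^esub> (d \<circ> b) y"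
      using bij_betwE[OF a] bij_betwE[OF b] by (simp add: H_def eq cd)
  qed
  ultimately show ?thesis by blast
qed

end

theory Submission
  imports Defs "HOL-Algebra.Coset"
begin

text \<open>
  An isotopy \<open>c\<close> is used as a chart of \<open>Q\<close> by the group \<open>G\<close>. In this chart each of the two
  distributive laws turns one factor of the isotopy into an affine map of \<open>G\<close>, so that the product
  becomes \<open>f X + e + g Y\<close> (written additively) with automorphisms \<open>f\<close> and \<open>g\<close> of \<open>G\<close>. Put back into
  this formula, the left F law forces \<open>f\<close> and \<open>g\<close> to commute, and forces \<open>-f X + X\<close> to be central;
  dually, \<open>X - g X\<close> is central (\<open>F_quasigroup_linear_form\<close>).

  Hence \<open>f\<close> and \<open>g\<close> induce the identity on \<open>G / Z(G)\<close>, where the product is simply \<open>X + e + Y\<close>.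
  The fibres of \<open>Q \<rightarrow> G / Z(G)\<close> are therefore the classes of a normal congruence
  (\<open>normal_congruence_kernel\<close>), and simplicity leaves two cases. If the congruence is equality, then
  \<open>Z(G)\<close> is trivial, so \<open>f\<close> and \<open>g\<close> are the identity and \<open>X + e + Y\<close> is the group operation
  shifted by \<open>e\<close> (\<open>is_group_translate\<close>). If it is total, then \<open>G\<close> is abelian, and since \<open>f\<close> and
  \<open>g\<close> commute the quasigroup is medial (\<open>medial_of_abelian_linear_form\<close>).
\<close>

section \<open>The opposite group and the centre\<close>

text \<open>Reversing both the quasigroup and the group exchanges the two F laws and the two factors
  of an isotopy; every fact about left F-quasigroups thereby yields its right-handed version.\<close>

definition opposite :: "('a, 'm) monoid_scheme \<Rightarrow> ('a, 'm) monoid_scheme" where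
  "opposite G = G\<lparr>monoid.mult := \<lambda>x y. y \<otimes>\<^bsub>G\<^esub> x\<rparr>"

definition center :: "('a, 'm) monoid_scheme \<Rightarrow> 'a set" where
  "center G = {z \<in> carrier G. \<forall>x\<in>carrier G. z \<otimes>\<^bsub>G\<^esub> x = x \<otimes>\<^bsub>G\<^esub> z}"

lemma opposite_simps [simp]:
  "carrier (opposite G) = carrier G" "\<one>\<^bsub>opposite G\<^esub> = \<one>\<^bsub>G\<^esub>"
  "x \<otimes>\<^bsub>opposite G\<^esub> y = y \<otimes>\<^bsub>G\<^esub> x"
  by (simp_all add: opposite_def)

lemma center_commute:
  "z \<in> center G \<Longrightarrow> x \<in> carrier G \<Longrightarrow> z \<otimes>\<^bsub>G\<^esub> x = x \<otimes>\<^bsub>G\<^esub> z"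
  by (simp add: center_def)

lemma center_opposite [simp]: "center (opposite G) = center G"
  by (auto simp: center_def)

lemma iso_opposite: "f \<in> iso G G \<Longrightarrow> f \<in> iso (opposite G) (opposite G)"
  by (auto simp: iso_def hom_def)

context group
begin

lemma group_opposite: "group (opposite G)"
  by (rule groupI) (auto simp: m_assoc)

lemma inv_opposite: "x \<in> carrier G \<Longrightarrow> inv\<^bsub>opposite G\<^esub> x = inv x"
  using group.inv_equality[OF group_opposite, of "inv x" x] by simp

lemma cancel_inv:
  assumes "x \<in> carrier G" "y \<in> carrier G"
  shows "inv x \<otimes> (x \<otimes> y) = y" "x \<otimes> (inv x \<otimes> y) = y"
  using assms by (simp_all flip: m_assoc)

lemma center_normal: "center G \<lhd> G"
proof -
  have "subgroup (center G) G"
  proof (rule subgroupI)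
    fix a assume a: "a \<in> center G"
    then have aG: "a \<in> carrier G" and com: "\<And>x. x \<in> carrier G \<Longrightarrow> a \<otimes> x = x \<otimes> a"
      by (auto simp: center_def)
    have "inv a \<otimes> x = x \<otimes> inv a" if x: "x \<in> carrier G" for x
      using com[of "inv x"] x aG by (metis inv_closed inv_inv inv_mult_group)
    then show "inv a \<in> center G" using aG by (simp add: center_def)
  next
    fix a b assume "a \<in> center G" "b \<in> center G"
    then have ab: "a \<in> carrier G" "b \<in> carrier G"
      and com: "\<And>x. x \<in> carrier G \<Longrightarrow> a \<otimes> x = x \<otimes> a"
        "\<And>x. x \<in> carrier G \<Longrightarrow> b \<otimes> x = x \<otimes> b"
      by (auto simp: center_def)
    have "a \<otimes> b \<otimes> x = x \<otimes> (a \<otimes> b)" if x: "x \<in> carrier G" for x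
    proof -
      have "a \<otimes> b \<otimes> x = a \<otimes> x \<otimes> b" using com(2)[OF x] ab x by (simp add: m_assoc)
      then show ?thesis using com(1)[OF x] ab x by (simp add: m_assoc)
    qed
    then show "a \<otimes> b \<in> center G" using ab by (simp add: center_def)
  qed (auto simp: center_def)
  moreover have "x \<otimes> h \<otimes> inv x \<in> center G" if "x \<in> carrier G" "h \<in> center G" for x h
  proof -
    have "h \<in> carrier G" "x \<otimes> h = h \<otimes> x" using that by (auto simp: center_def)
    then have "x \<otimes> h \<otimes> inv x = h" using that(1) by (simp add: m_assoc)
    then show ?thesis using that by simp
  qed
  ultimately show ?thesis by (auto simp: normal_inv_iff)
qed

section \<open>Affine maps of a group\<close>

text \<open>Setting one argument to the neutral element gives \<open>p u = B u \<otimes> inv (q \<one>)\<close> and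
  \<open>q v = inv (p \<one>) \<otimes> B v\<close>; in the product of the two, the constants combine to the inverse of
  \<open>p \<one> \<otimes> q \<one> = B \<one>\<close>.\<close>

lemma quasihomomorphism_affine:
  assumes pq: "\<And>u. u \<in> carrier G \<Longrightarrow> p u \<in> carrier G" "\<And>v. v \<in> carrier G \<Longrightarrow> q v \<in> carrier G"
    and B: "\<And>u v. u \<in> carrier G \<Longrightarrow> v \<in> carrier G \<Longrightarrow> B (u \<otimes> v) = p u \<otimes> q v"
    and u: "u \<in> carrier G" and v: "v \<in> carrier G"
  shows "B (u \<otimes> v) = B u \<otimes> inv (B \<one>) \<otimes> B v"
  using B[of u v] B[of u \<one>] B[of \<one> v] B[of \<one> \<one>] pq u v
  by (simp add: m_assoc inv_mult_group cancel_inv)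

lemma affine_bij_linear_part:
  assumes bij: "bij_betw B (carrier G) (carrier G)"
    and aff: "\<And>u v. u \<in> carrier G \<Longrightarrow> v \<in> carrier G \<Longrightarrow> B (u \<otimes> v) = B u \<otimes> inv (B \<one>) \<otimes> B v"
  shows "(\<lambda>u. inv (B \<one>) \<otimes> B u) \<in> iso G G"
proof -
  have BG: "B u \<in> carrier G" if "u \<in> carrier G" for u using bij that by (blast dest: bij_betwE)
  have "(\<lambda>u. inv (B \<one>) \<otimes> B u) \<in> hom G G"
    by (rule homI) (simp_all add: BG aff m_assoc)
  moreover have "bij_betw ((\<lambda>u. inv (B \<one>) \<otimes> u) \<circ> B) (carrier G) (carrier G)"
    by (rule bij_betw_trans[OF bij])
      (rule bij_betw_byWitness[where f' = "\<lambda>u. B \<one> \<otimes> u"], auto simp: BG cancel_inv)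
  ultimately show ?thesis by (simp add: iso_def comp_def)
qed

end

section \<open>Opposite quasigroups\<close>

lemma (in quasigroup) quasigroup_opposite: "quasigroup Q (\<lambda>x y. y \<cdot> x)"
  by unfold_locales (rule nonempty, erule bij_right, erule bij_left)

lemma (in right_F_quasigroup) left_F_quasigroup_opposite:
  "left_F_quasigroup Q (\<lambda>x y. y \<cdot> x)"
proof -
  interpret op: quasigroup Q "\<lambda>x y. y \<cdot> x" by (rule quasigroup_opposite)
  have "op.\<alpha> x = \<beta> x" for x by (simp add: op.\<alpha>_def \<beta>_def)
  then show ?thesis by unfold_locales (simp add: right_F)
qed

section \<open>Left F-quasigroups isotopic to a group\<close>

lemma bij_betw_preimage: "bij_betw c Q S \<Longrightarrow> X \<in> S \<Longrightarrow> \<exists>x\<in>Q. c x = X"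
  by (auto simp: bij_betw_def)

text \<open>For a fixed \<open>x\<close>, the law \<open>x \<cdot> yz = xy \<cdot> \<alpha>(x)z\<close> expresses \<open>B (A Y + B Z)\<close> as a function of
  \<open>Y\<close> plus a function of \<open>Z\<close>. Since \<open>A Y\<close> and \<open>B Z\<close> range over all of \<open>G\<close>, this is the hypothesis
  of \<open>quasihomomorphism_affine\<close> for \<open>B\<close>.\<close>

lemma left_F_isotopy_affine:
  fixes G (structure)
  assumes "left_F_quasigroup Q mul" and "group G"
    and c: "bij_betw c Q (carrier G)"
    and A: "bij_betw A (carrier G) (carrier G)" and B: "bij_betw B (carrier G) (carrier G)"
    and mult: "\<And>x y. x \<in> Q \<Longrightarrow> y \<in> Q \<Longrightarrow> c (mul x y) = A (c x) \<otimes>\<^bsub>G\<^esub> B (c y)"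
    and u: "u \<in> carrier G" and v: "v \<in> carrier G"
  shows "B (u \<otimes>\<^bsub>G\<^esub> v) = B u \<otimes>\<^bsub>G\<^esub> inv\<^bsub>G\<^esub> (B \<one>\<^bsub>G\<^esub>) \<otimes>\<^bsub>G\<^esub> B v"
proof -
  interpret left_F_quasigroup Q mul by fact
  interpret group G by fact
  have AG: "A w \<in> carrier G" if "w \<in> carrier G" for w using A that by (blast dest: bij_betwE)
  have BG: "B w \<in> carrier G" if "w \<in> carrier G" for w using B that by (blast dest: bij_betwE)
  have cG: "c x \<in> carrier G" if "x \<in> Q" for x using c that by (blast dest: bij_betwE)
  obtain x where x: "x \<in> Q" using nonempty by blast
  define A' where "A' = inv_into (carrier G) A"
  have A': "A' w \<in> carrier G" "A (A' w) = w" if "w \<in> carrier G" for w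
    using A that unfolding A'_def by (auto simp: bij_betw_def inv_into_into f_inv_into_f)
  define p where "p w = inv (A (c x)) \<otimes> A (A (c x) \<otimes> B (A' w))" for w
  define q where "q w = B (A (c (\<alpha> x)) \<otimes> w)" for w
  have "B (w \<otimes> w') = p w \<otimes> q w'" if w: "w \<in> carrier G" and w': "w' \<in> carrier G" for w w'
  proof -
    obtain y where y: "y \<in> Q" "c y = A' w"
      using bij_betw_preimage[OF c A'(1)[OF w]] by blast
    obtain z where z: "z \<in> Q" "B (c z) = w'"
      using bij_betw_preimage[OF bij_betw_trans[OF c B] w'] by auto
    have "c (mul x (mul y z)) = c (mul (mul x y) (mul (\<alpha> x) z))"
      using left_F x y z by simp
    then have "A (c x) \<otimes> B (w \<otimes> w') = A (A (c x) \<otimes> B (A' w)) \<otimes> q w'"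
      using x y z by (simp add: mult mul_closed \<alpha> A'(2) w q_def)
    then have "inv (A (c x)) \<otimes> (A (c x) \<otimes> B (w \<otimes> w')) = p w \<otimes> q w'"
      using x w w' by (simp add: p_def q_def m_assoc cG AG BG A'(1) \<alpha>)
    then show ?thesis using x w w' by (simp add: cancel_inv cG AG BG)
  qed
  moreover have "p w \<in> carrier G" "q w \<in> carrier G" if "w \<in> carrier G" for w
    using that x by (simp_all add: p_def q_def cG AG BG A'(1) \<alpha>)
  ultimately show ?thesis by (intro quasihomomorphism_affine[of p q B] u v)
qed

text \<open>
  In the chart, at a \<open>z\<close> of coordinate \<open>0\<close>, the left F law reads, after cancelling \<open>g e\<close>,
  \<open>f X + e + g (f Y) = f (f X) + f e + f (g Y) + r X\<close> with some \<open>r X\<close> independent of \<open>Y\<close>. The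
  value \<open>Y = 0\<close> determines \<open>r\<close>, and then \<open>X = 0\<close> expresses \<open>g (f Y)\<close> through \<open>f (g Y)\<close>. After both
  substitutions the identity says that \<open>-f P + P\<close>, with \<open>P = f X\<close>, commutes with
  \<open>f e + f (g Y) - f e\<close>, which is an arbitrary element. Centrality at \<open>P = e\<close> in turn reduces the
  case \<open>X = 0\<close> to \<open>g (f Y) = f (g Y)\<close>.
\<close>

lemma left_F_linear_form:
  fixes G (structure)
  assumes "left_F_quasigroup Q mul" and "group G"
    and c: "bij_betw c Q (carrier G)"
    and f: "f \<in> iso G G" and g: "g \<in> iso G G" and e: "e \<in> carrier G"
    and mult: "\<And>x y. x \<in> Q \<Longrightarrow> y \<in> Q \<Longrightarrow> c (mul x y) = f (c x) \<otimes>\<^bsub>G\<^esub> e \<otimes>\<^bsub>G\<^esub> g (c y)"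
  shows left_F_central_displacement:
      "P \<in> carrier G \<Longrightarrow> inv\<^bsub>G\<^esub> (f P) \<otimes>\<^bsub>G\<^esub> P \<in> center G"
    and left_F_automorphisms_commute: "Y \<in> carrier G \<Longrightarrow> g (f Y) = f (g Y)"
proof -
  interpret left_F_quasigroup Q mul by fact
  interpret group G by fact
  interpret f: group_hom G G f using f by (unfold_locales) (simp add: iso_def)
  interpret g: group_hom G G g using g by (unfold_locales) (simp add: iso_def)
  have cG: "c x \<in> carrier G" if "x \<in> Q" for x using c that by (blast dest: bij_betwE)
  have chart: "\<exists>x\<in>Q. c x = X" if "X \<in> carrier G" for X
    using bij_betw_preimage[OF c that] .
  have onto: "\<exists>X\<in>carrier G. h X = Y" if "h \<in> iso G G" "Y \<in> carrier G" for h Y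
    using that bij_betw_preimage by (auto simp: iso_def)
  have e_closed [simp]: "e \<in> carrier G" by fact
  have "\<exists>r\<in>carrier G. \<forall>Y\<in>carrier G. f X \<otimes> e \<otimes> g (f Y) = f (f X) \<otimes> f e \<otimes> f (g Y) \<otimes> r"
    if X: "X \<in> carrier G" for X
  proof -
    obtain x where x: "x \<in> Q" "c x = X" using chart X by blast
    obtain z where z: "z \<in> Q" "c z = \<one>" using chart by blast
    \<comment> \<open>the contribution of \<open>\<alpha> x\<close>, which enters the identity only as a constant for fixed \<open>X\<close>\<close>
    define r where "r = e \<otimes> g (f (c (\<alpha> x)))"
    have r: "r \<in> carrier G" using x by (simp add: r_def cG \<alpha>)
    have "f X \<otimes> e \<otimes> g (f Y) = f (f X) \<otimes> f e \<otimes> f (g Y) \<otimes> r" if Y: "Y \<in> carrier G" for Y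
    proof -
      obtain y where y: "y \<in> Q" "c y = Y" using chart Y by blast
      have "c (mul x (mul y z)) = c (mul (mul x y) (mul (\<alpha> x) z))"
        using left_F x y z by simp
      then have "(f X \<otimes> e \<otimes> g (f Y)) \<otimes> g e = (f (f X) \<otimes> f e \<otimes> f (g Y) \<otimes> r) \<otimes> g e"
        using x y z X Y by (simp add: mult mul_closed \<alpha> cG r_def m_assoc)
      then show ?thesis using X Y r by simp
    qed
    with r show ?thesis by blast
  qed
  then obtain r where r: "\<And>X. X \<in> carrier G \<Longrightarrow> r X \<in> carrier G"
    and key: "\<And>X Y. X \<in> carrier G \<Longrightarrow> Y \<in> carrier G \<Longrightarrow>
        f X \<otimes> e \<otimes> g (f Y) = f (f X) \<otimes> f e \<otimes> f (g Y) \<otimes> r X"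
    by metis
  have r_eq: "r X = inv (f e) \<otimes> inv (f (f X)) \<otimes> f X \<otimes> e" if X: "X \<in> carrier G" for X
  proof -
    have "f X \<otimes> e = f (f X) \<otimes> (f e \<otimes> r X)" using key[OF X, of \<one>] X r by (simp add: m_assoc)
    then have "inv (f e) \<otimes> inv (f (f X)) \<otimes> (f X \<otimes> e)
        = inv (f e) \<otimes> inv (f (f X)) \<otimes> (f (f X) \<otimes> (f e \<otimes> r X))" by simp
    also have "\<dots> = r X" using X r by (simp add: m_assoc cancel_inv)
    finally show ?thesis using X by (simp add: m_assoc)
  qed
  have comm: "e \<otimes> g (f Y) = f e \<otimes> f (g Y) \<otimes> inv (f e) \<otimes> e" if Y: "Y \<in> carrier G" for Y
    using key[of \<one> Y] Y by (simp add: r_eq m_assoc)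
  show central: "inv (f P) \<otimes> P \<in> center G" if P: "P \<in> carrier G" for P
  proof -
    have "inv (f P) \<otimes> P \<otimes> v = v \<otimes> (inv (f P) \<otimes> P)" if v: "v \<in> carrier G" for v
    proof -
      obtain X where X: "X \<in> carrier G" "f X = P" using onto[OF f P] by blast
      \<comment> \<open>chosen so that conjugation by \<open>f e\<close> takes \<open>f (g Y)\<close> to the given \<open>v\<close>\<close>
      obtain Y where Y: "Y \<in> carrier G" "f (g Y) = inv (f e) \<otimes> v \<otimes> f e"
        using onto[OF f, of "inv (f e) \<otimes> v \<otimes> f e"] onto[OF g] v
        by (metis e_closed f.hom_closed inv_closed m_closed)
      have "e \<otimes> g (f Y) = v \<otimes> e"
        using comm[OF Y(1)] v by (simp add: Y(2) m_assoc cancel_inv)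
      then have "P \<otimes> v \<otimes> e = f X \<otimes> e \<otimes> g (f Y)" using X Y(1) v P by (simp add: m_assoc)
      also have "\<dots> = f (f X) \<otimes> f e \<otimes> f (g Y) \<otimes> r X" by (rule key[OF X(1) Y(1)])
      also have "\<dots> = f P \<otimes> v \<otimes> inv (f P) \<otimes> P \<otimes> e"
        using v P by (simp add: r_eq X Y(2) m_assoc cancel_inv)
      finally have "P \<otimes> v = f P \<otimes> v \<otimes> inv (f P) \<otimes> P" using v P by simp
      then have "inv (f P) \<otimes> (P \<otimes> v) = inv (f P) \<otimes> (f P \<otimes> v \<otimes> inv (f P) \<otimes> P)" by simp
      then show ?thesis using v P by (simp add: m_assoc cancel_inv)
    qed
    then show ?thesis using P by (simp add: center_def)
  qed
  show "g (f Y) = f (g Y)" if Y: "Y \<in> carrier G" for Y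
  proof -
    have "e \<otimes> g (f Y) = f e \<otimes> (f (g Y) \<otimes> (inv (f e) \<otimes> e))"
      using comm[OF Y] Y by (simp add: m_assoc)
    also have "\<dots> = f e \<otimes> (inv (f e) \<otimes> e \<otimes> f (g Y))"
      using central[OF e] Y by (simp add: center_def)
    also have "\<dots> = e \<otimes> f (g Y)" using Y by (simp add: m_assoc cancel_inv)
    finally show ?thesis using Y by simp
  qed
qed

section \<open>Linear representation of F-quasigroups isotopic to a group\<close>

text \<open>The two halves come from the left-handed lemmas, applied to \<open>Q\<close> and to its opposite. The
  linear parts are split off on the outer sides, as \<open>A u - A 0\<close> and \<open>-B 0 + B u\<close>, so that the
  constants meet in the middle as \<open>e = A 0 + B 0\<close>.\<close>

lemma F_quasigroup_linear_form:
  fixes G (structure)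
  assumes "F_quasigroup Q mul" and "group G" and "isotopic_to Q mul G"
  obtains c f e g where "bij_betw c Q (carrier G)"
    "f \<in> iso G G" "g \<in> iso G G" "e \<in> carrier G"
    "\<And>x y. x \<in> Q \<Longrightarrow> y \<in> Q \<Longrightarrow> c (mul x y) = f (c x) \<otimes> e \<otimes> g (c y)"
    "\<And>X. X \<in> carrier G \<Longrightarrow> inv (f X) \<otimes> X \<in> center G"
    "\<And>X. X \<in> carrier G \<Longrightarrow> X \<otimes> inv (g X) \<in> center G"
    "\<And>X. X \<in> carrier G \<Longrightarrow> g (f X) = f (g X)"
proof -
  interpret F_quasigroup Q mul by fact
  have left: "left_F_quasigroup Q mul" and right: "left_F_quasigroup Q (\<lambda>x y. mul y x)"
    by (rule left_F_quasigroup_axioms, rule left_F_quasigroup_opposite)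
  obtain a b c where a: "bij_betw a Q (carrier G)" and b: "bij_betw b Q (carrier G)"
    and c: "bij_betw c Q (carrier G)"
    and ab: "\<And>x y. x \<in> Q \<Longrightarrow> y \<in> Q \<Longrightarrow> c (mul x y) = a x \<otimes> b y"
    using assms(3) unfolding isotopic_to_def by blast
  interpret group G by fact
  note op = group_opposite
  define A where "A = a \<circ> inv_into Q c"
  define B where "B = b \<circ> inv_into Q c"
  have A: "bij_betw A (carrier G) (carrier G)" and B: "bij_betw B (carrier G) (carrier G)"
    unfolding A_def B_def using bij_betw_inv_into[OF c] a b by (blast intro: bij_betw_trans)+
  have AB: "c (mul x y) = A (c x) \<otimes> B (c y)" if "x \<in> Q" "y \<in> Q" for x y
    using ab that c by (simp add: A_def B_def bij_betw_def inv_into_f_f)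
  have AG: "A w \<in> carrier G" if "w \<in> carrier G" for w using A that by (blast dest: bij_betwE)
  have BG: "B w \<in> carrier G" if "w \<in> carrier G" for w using B that by (blast dest: bij_betwE)
  have cG: "c x \<in> carrier G" if "x \<in> Q" for x using c that by (blast dest: bij_betwE)
  define f where "f = (\<lambda>u. A u \<otimes> inv (A \<one>))"
  define g where "g = (\<lambda>u. inv (B \<one>) \<otimes> B u)"
  define e where "e = A \<one> \<otimes> B \<one>"
  have B_affine: "B (u \<otimes> v) = B u \<otimes> inv (B \<one>) \<otimes> B v"
    if "u \<in> carrier G" "v \<in> carrier G" for u v
    by (rule left_F_isotopy_affine[OF left group_axioms c A B AB that])
  have A_affine: "A (v \<otimes> u) = A v \<otimes> (inv (A \<one>) \<otimes> A u)"
    if "u \<in> carrier G" "v \<in> carrier G" for u v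
    using left_F_isotopy_affine[OF right op, of c B A u v] c A B AB that
    by (simp add: inv_opposite AG)
  have g: "g \<in> iso G G" unfolding g_def using affine_bij_linear_part[OF B B_affine] .
  have "f \<in> iso (opposite G) (opposite G)"
    using group.affine_bij_linear_part[OF op, of A] A A_affine
    by (simp add: inv_opposite AG f_def)
  then have f: "f \<in> iso G G" using iso_opposite[of f "opposite G"] by (simp add: opposite_def)
  have e: "e \<in> carrier G" by (simp add: e_def AG BG)
  have mult: "c (mul x y) = f (c x) \<otimes> e \<otimes> g (c y)" if "x \<in> Q" "y \<in> Q" for x y
    using AB that by (simp add: f_def g_def e_def m_assoc cancel_inv AG BG cG)
  have gG: "g X \<in> carrier G" if "X \<in> carrier G" for X
    using g that by (auto simp: iso_def hom_def)
  have fG: "f X \<in> carrier G" if "X \<in> carrier G" for X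
    using f that by (auto simp: iso_def hom_def)
  have "X \<otimes> inv (g X) \<in> center G" if "X \<in> carrier G" for X
    using left_F_central_displacement[OF right op, of c g f e X] c f g e mult that
    by (simp add: inv_opposite iso_opposite m_assoc cG fG gG)
  then show thesis
    by (intro that[of c f g e] c f g e mult
      left_F_central_displacement[OF left group_axioms c f g e mult]
      left_F_automorphisms_commute[OF left group_axioms c f g e mult])
qed

section \<open>The congruence modulo the centre\<close>

text \<open>Compatibility with division comes for free: the shifted product on \<open>K\<close> can be cancelled.\<close>

lemma (in quasigroup) normal_congruence_kernel:
  fixes K (structure)
  assumes "group K" and e: "e \<in> carrier K" and h: "\<And>x. x \<in> Q \<Longrightarrow> h x \<in> carrier K"
    and mult: "\<And>x y. x \<in> Q \<Longrightarrow> y \<in> Q \<Longrightarrow> h (x \<cdot> y) = h x \<otimes>\<^bsub>K\<^esub> e \<otimes>\<^bsub>K\<^esub> h y"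
  shows "normal_congruence {(x, y). x \<in> Q \<and> y \<in> Q \<and> h x = h y}" (is "normal_congruence ?\<theta>")
proof -
  interpret group K by fact
  have "equiv Q ?\<theta>"
    by (rule equivI) (auto simp: refl_on_def sym_def trans_def)
  moreover have "h (ldiv x y) = h (ldiv x' y')"
    if "x \<in> Q" "y \<in> Q" "x' \<in> Q" "y' \<in> Q" "h x = h x'" "h y = h y'" for x y x' y'
  proof -
    have "h x \<otimes> e \<otimes> h (ldiv x y) = h x \<otimes> e \<otimes> h (ldiv x' y')"
      using mult[of x "ldiv x y"] mult[of x' "ldiv x' y'"] ldiv that by simp
    then show ?thesis using that e by (simp add: h ldiv)
  qed
  moreover have "h (rdiv x y) = h (rdiv x' y')"
    if "x \<in> Q" "y \<in> Q" "x' \<in> Q" "y' \<in> Q" "h x = h x'" "h y = h y'" for x y x' y'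
  proof -
    have "h (rdiv x y) \<otimes> (e \<otimes> h y) = h (rdiv x' y') \<otimes> (e \<otimes> h y)"
      using mult[of "rdiv x y" y] mult[of "rdiv x' y'" y'] rdiv that e by (simp add: h m_assoc)
    then show ?thesis using that e by (simp add: h rdiv)
  qed
  ultimately show ?thesis
    unfolding normal_congruence_def by (auto simp: mult mul_closed ldiv rdiv)
qed

section \<open>The two extreme cases\<close>

text \<open>The map \<open>x \<mapsto> c x + e\<close> carries \<open>Q\<close> onto \<open>G\<close> multiplicatively; the neutral element is thus the
  point of coordinate \<open>-e\<close>.\<close>

lemma is_group_translate:
  fixes G (structure)
  assumes "quasigroup Q mul" and "group G"
    and c: "bij_betw c Q (carrier G)" and e: "e \<in> carrier G"
    and mult: "\<And>x y. x \<in> Q \<Longrightarrow> y \<in> Q \<Longrightarrow> c (mul x y) = c x \<otimes>\<^bsub>G\<^esub> e \<otimes>\<^bsub>G\<^esub> c y"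
  shows "is_group Q mul"
proof -
  interpret quasigroup Q mul by fact
  interpret group G by fact
  have cG: "c x \<in> carrier G" if "x \<in> Q" for x using c that by (blast dest: bij_betwE)
  have inj: "x = y" if "c x = c y" "x \<in> Q" "y \<in> Q" for x y
    using c that by (auto simp: bij_betw_def inj_on_def)
  have chart: "\<exists>x\<in>Q. c x = X" if "X \<in> carrier G" for X
    using bij_betw_preimage[OF c that] .
  obtain u where u: "u \<in> Q" "c u = inv e" using chart e by blast
  have "group \<lparr>carrier = Q, monoid.mult = mul, one = u\<rparr>"
  proof (rule groupI, simp_all add: u mul_closed)
    fix x y z assume "x \<in> Q" "y \<in> Q" "z \<in> Q"
    then show "mul (mul x y) z = mul x (mul y z)"
      by (intro inj) (simp_all add: mult mul_closed cG e m_assoc)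
  next
    fix x assume x: "x \<in> Q"
    show "mul u x = x" by (rule inj) (simp_all add: mult u x mul_closed cG e)
    show "\<exists>y\<in>Q. mul y x = u" using rdiv[OF x u(1)] by blast
  qed
  then show ?thesis unfolding is_group_def by blast
qed

text \<open>In \<open>xa \<cdot> by\<close> the middle elements contribute \<open>f (g a)\<close> and \<open>g (f b)\<close>; since \<open>f\<close> and \<open>g\<close>
  commute, these two terms are interchangeable.\<close>

lemma medial_of_abelian_linear_form:
  fixes G (structure)
  assumes "quasigroup Q mul" and "comm_group G"
    and c: "bij_betw c Q (carrier G)"
    and f: "f \<in> hom G G" and g: "g \<in> hom G G" and e: "e \<in> carrier G"
    and mult: "\<And>x y. x \<in> Q \<Longrightarrow> y \<in> Q \<Longrightarrow> c (mul x y) = f (c x) \<otimes>\<^bsub>G\<^esub> e \<otimes>\<^bsub>G\<^esub> g (c y)"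
    and comm: "\<And>X. X \<in> carrier G \<Longrightarrow> g (f X) = f (g X)"
  shows "medial_quasigroup Q mul"
proof -
  interpret quasigroup Q mul by fact
  interpret comm_group G by fact
  interpret f: group_hom G G f using f by unfold_locales
  interpret g: group_hom G G g using g by unfold_locales
  have cG: "c x \<in> carrier G" if "x \<in> Q" for x using c that by (blast dest: bij_betwE)
  have inj: "x = y" if "c x = c y" "x \<in> Q" "y \<in> Q" for x y
    using c that by (auto simp: bij_betw_def inj_on_def)
  show ?thesis
    by unfold_locales
      (rule inj, simp_all add: mult mul_closed cG e comm m_ac)
qed

section \<open>Simple F-quasigroups isotopic to a group\<close>

theorem simple_F_quasigroup_isotopic_to_group:
  fixes G (structure)
  assumes "F_quasigroup Q mul" and "simple_quasigroup Q mul"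
    and "group G" and "isotopic_to Q mul G"
  shows "medial_quasigroup Q mul \<or> is_group Q mul"
proof -
  interpret simple_quasigroup Q mul by fact
  obtain c f e g where c: "bij_betw c Q (carrier G)"
    and f: "f \<in> iso G G" and g: "g \<in> iso G G" and e: "e \<in> carrier G"
    and mult: "\<And>x y. x \<in> Q \<Longrightarrow> y \<in> Q \<Longrightarrow> c (mul x y) = f (c x) \<otimes> e \<otimes> g (c y)"
    and f_central: "\<And>X. X \<in> carrier G \<Longrightarrow> inv (f X) \<otimes> X \<in> center G"
    and g_central: "\<And>X. X \<in> carrier G \<Longrightarrow> X \<otimes> inv (g X) \<in> center G"
    and comm: "\<And>X. X \<in> carrier G \<Longrightarrow> g (f X) = f (g X)"
    using F_quasigroup_linear_form[OF assms(1,3,4)] by metis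
  interpret group G by fact
  interpret f: group_hom G G f using f by unfold_locales (simp add: iso_def)
  interpret g: group_hom G G g using g by unfold_locales (simp add: iso_def)
  interpret Z: normal "center G" G by (rule center_normal)
  define K where "K = G Mod center G"
  define \<pi> where "\<pi> = (\<lambda>X. center G #> X)"
  interpret \<pi>: group_hom G K \<pi>
    using Z.r_coset_hom_Mod Z.factorgroup_is_group unfolding \<pi>_def K_def
    by (intro group_hom.intro group_hom_axioms.intro group_axioms)
  have \<pi>_eq_one_iff: "\<pi> X = \<one>\<^bsub>K\<^esub> \<longleftrightarrow> X \<in> center G" if "X \<in> carrier G" for X
    using coset_join1[OF _ that Z.subgroup_axioms] coset_join2[OF that Z.subgroup_axioms]
    by (auto simp: \<pi>_def K_def FactGroup_def)
  have \<pi>_f: "\<pi> (f X) = \<pi> X" if X: "X \<in> carrier G" for X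
  proof -
    have "inv\<^bsub>K\<^esub> \<pi> (f X) \<otimes>\<^bsub>K\<^esub> \<pi> X = \<one>\<^bsub>K\<^esub>"
      using \<pi>_eq_one_iff f_central X by (simp flip: \<pi>.hom_inv \<pi>.hom_mult)
    then show ?thesis using X by (simp add: \<pi>.inv_solve_left')
  qed
  have \<pi>_g: "\<pi> (g X) = \<pi> X" if X: "X \<in> carrier G" for X
  proof -
    have "\<pi> X \<otimes>\<^bsub>K\<^esub> inv\<^bsub>K\<^esub> \<pi> (g X) = \<one>\<^bsub>K\<^esub>"
      using \<pi>_eq_one_iff g_central X by (simp flip: \<pi>.hom_inv \<pi>.hom_mult)
    then show ?thesis using X by (simp add: \<pi>.inv_solve_right')
  qed
  have cG: "c x \<in> carrier G" if "x \<in> Q" for x using c that by (blast dest: bij_betwE)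
  have chart: "\<exists>x\<in>Q. c x = X" if "X \<in> carrier G" for X
    using bij_betw_preimage[OF c that] .
  have "normal_congruence {(x, y). x \<in> Q \<and> y \<in> Q \<and> \<pi> (c x) = \<pi> (c y)}"
    by (rule normal_congruence_kernel[where K = K and e = "\<pi> e"])
      (simp_all add: \<pi>.H.group_axioms e cG mult \<pi>_f \<pi>_g)
  then consider
      (trivial) "{(x, y). x \<in> Q \<and> y \<in> Q \<and> \<pi> (c x) = \<pi> (c y)} = Id_on Q"
    | (total) "{(x, y). x \<in> Q \<and> y \<in> Q \<and> \<pi> (c x) = \<pi> (c y)} = Q \<times> Q"
    using simple by blast
  then show ?thesis
  proof cases
    case trivial
    have center: "z = \<one>" if z: "z \<in> center G" for z
    proof -
      have zG: "z \<in> carrier G" using Z.mem_carrier[OF z] .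
      obtain x where x: "x \<in> Q" "c x = z" using chart[OF zG] by blast
      obtain y where y: "y \<in> Q" "c y = \<one>" using chart[OF one_closed] by blast
      have "(x, y) \<in> {(x, y). x \<in> Q \<and> y \<in> Q \<and> \<pi> (c x) = \<pi> (c y)}"
        using x y \<pi>_eq_one_iff[OF zG] z by simp
      then show ?thesis using x y unfolding trivial by auto
    qed
    have "f X = X" if X: "X \<in> carrier G" for X
      using center[OF f_central[OF X]] X
      by (metis f.hom_closed inv_comm inv_equality inv_closed inv_inv)
    moreover have "g X = X" if X: "X \<in> carrier G" for X
      using center[OF g_central[OF X]] X
      by (metis g.hom_closed inv_equality inv_closed inv_inv)
    ultimately have "is_group Q mul"
      by (intro is_group_translate[OF quasigroup_axioms group_axioms c e]) (simp add: mult cG)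
    then show ?thesis ..
  next
    case total
    have "X \<in> center G" if X: "X \<in> carrier G" for X
    proof -
      obtain x where x: "x \<in> Q" "c x = X" using chart[OF X] by blast
      obtain y where y: "y \<in> Q" "c y = \<one>" using chart[OF one_closed] by blast
      have "(x, y) \<in> {(x, y). x \<in> Q \<and> y \<in> Q \<and> \<pi> (c x) = \<pi> (c y)}"
        unfolding total using x y by simp
      then show ?thesis using x y \<pi>_eq_one_iff[OF X] by simp
    qed
    then have "comm_group G" by (intro group_comm_groupI) (rule center_commute)
    then have "medial_quasigroup Q mul"
      using medial_of_abelian_linear_form[OF quasigroup_axioms _ c f.homh g.homh e mult comm]
      by blast
    then show ?thesis ..
  qed
qed

theorem corollary5p7:
  fixes Q :: "'a set" and mul :: "'a \<Rightarrow> 'a \<Rightarrow> 'a"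
  assumes "FG_quasigroup Q mul" and "simple_quasigroup Q mul"
  shows "medial_quasigroup Q mul \<or> is_group Q mul"
proof -
  interpret FG_quasigroup Q mul by fact
  show ?thesis
    using isotopic_group simple_F_quasigroup_isotopic_to_group[OF F_quasigroup_axioms assms(2)]
    by blast
qed

end
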